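(* Let $\mathcal C\subset\mathbb{P}^{n-1}$ be a real polyhedral cone, let $\Gamma\subset\Sigma$ be a finite set, and let $\mathcal H,\mathcal H'\in\Sigma$ have distinct apices. If $\mathcal H'\notin\tau(\Gamma)$ and $\mathcal H'\in\tau(\{\mathcal H\}\cup\Gamma)$, then $\mathcal H\notin\tau(\{\mathcal H'\}\cup\Gamma)$.
   Context: Max-plus semiring $\mathbb{R}_{\max}=\mathbb{R}\cup\{-\infty\}$ with $\oplus=\max$, $\otimes=+$; on $\mathbb{R}_{\max}^n$, componentwise maximum and $\lambda x=(\lambda+x_1,\dots,\lambda+x_n)$. A real polyhedral cone is $\mathcal C=\{\lambda_1v^1\oplus\dots\oplus\lambda_pv^p:\lambda_r\in\mathbb{R}_{\max}\}$ with $v^1,\dots,v^p\in\mathbb{R}^n$, identified with its image in $\mathbb{P}^{n-1}=\mathbb{R}^n/\mathbb{R}(1,\dots,1)$. For $a\in\mathbb{R}^n$ and non-empty proper $I\subsetneq[n]$, the tropical half-space $\mathcal H(a,I)=\{x\in\mathbb{R}_{\max}^n\setminus\{(-\infty,\dots,-\infty)\}:\max_{i\in I}(x_i-a_i)\ge\max_{j\notin I}(x_j-a_j)\}$ (modulo adding constants) has apex $a\in\mathbb{P}^{n-1}$ and sectors $I$, both uniquely determined. Let $\Sigma$ be the set of all half-spaces $\mathcal H(a,I)$ with $\mathcal C\subset\mathcal H(a,I)$ and $a\in\mathcal C$. For $\Gamma\subset\Sigma$ define $\tau(\Gamma)=\{\mathcal H\in\Sigma:\bigcap_{\mathcal H'\in\Gamma}\mathcal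 H'\subset\mathcal H\}$, with the convention $\tau(\emptyset)=\emptyset$. *)

theory Defs
  imports "HOL-Analysis.Analysis"
begin

text \<open>
  The max-plus semiring is modelled inside \<^typ>\<open>ereal\<close>: its elements are the extended reals
  other than \<open>\<infinity>\<close>, its sum is \<open>max\<close> and its product is \<open>+\<close>. Finite maxima are written as
  suprema, so that a maximum over an empty family is \<open>-\<infinity>\<close>, the zero of the semiring.
\<close>

definition rmax :: "ereal set" where
  "rmax = {x. x \<noteq> \<infinity>}"

definition rmax_nonzero :: "(ereal ^ 'n) set" where
  "rmax_nonzero = {x. (\<forall>i. x $ i \<in> rmax) \<and> x \<noteq> (\<chi> i. -\<infinity>)}"

definition real_vec :: "real ^ 'n \<Rightarrow> ereal ^ 'n" where
  "real_vec a = (\<chi> i. ereal (a $ i))"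

text \<open>
  Classes modulo the addition of real constants. The projective space \<open>\<real>\<^sup>n / \<real>(1, \<dots>, 1)\<close> is the
  range of \<open>\<lambda>a. proj (real_vec a)\<close>; half-spaces also contain classes of vectors with
  some (but not all) entries \<open>-\<infinity>\<close>.
\<close>

definition proj :: "ereal ^ 'n \<Rightarrow> (ereal ^ 'n) set" where
  "proj x = {(\<chi> i. ereal c + x $ i) |c. True}"

definition max_plus_span :: "nat \<Rightarrow> (nat \<Rightarrow> real ^ 'n) \<Rightarrow> (ereal ^ 'n) set" where
  "max_plus_span p v =
     {(\<chi> i. SUP r\<in>{1..p}. l r + real_vec (v r) $ i) |l. \<forall>r\<in>{1..p}. l r \<in> rmax}"

definition real_polyhedral_cone :: "(ereal ^ 'n) set set \<Rightarrow> bool" where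
  "real_polyhedral_cone C \<longleftrightarrow> (\<exists>p v. C = proj ` (max_plus_span p v \<inter> rmax_nonzero))"

definition trop_halfspace :: "real ^ 'n \<Rightarrow> 'n set \<Rightarrow> (ereal ^ 'n) set set" where
  "trop_halfspace a I =
     proj ` {x \<in> rmax_nonzero. (SUP i\<in>I. x $ i - ereal (a $ i)) \<ge> (SUP j\<in>-I. x $ j - ereal (a $ j))}"

text \<open>The apex, as a point of projective space; it is well defined by \<open>apex_trop_halfspace\<close> below.\<close>

definition apex :: "(ereal ^ 'n) set set \<Rightarrow> (ereal ^ 'n) set" where
  "apex H = (THE A. \<exists>a I. I \<noteq> {} \<and> I \<noteq> UNIV \<and> H = trop_halfspace a I \<and> A = proj (real_vec a))"

definition Sigma_halfspaces :: "(ereal ^ 'n) set set \<Rightarrow> (ereal ^ 'n) set set set" where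
  "Sigma_halfspaces C = {trop_halfspace a I |a I.
     I \<noteq> {} \<and> I \<noteq> UNIV \<and> C \<subseteq> trop_halfspace a I \<and> proj (real_vec a) \<in> C}"

definition tau :: "(ereal ^ 'n) set set \<Rightarrow> (ereal ^ 'n) set set set \<Rightarrow> (ereal ^ 'n) set set set" where
  "tau C \<Gamma> = (if \<Gamma> = {} then {} else {H \<in> Sigma_halfspaces C. \<Inter>\<Gamma> \<subseteq> H})"

lemma SUP_le_SUP_finite_iff:
  fixes f g :: "'n::finite \<Rightarrow> ereal"
  assumes "I \<noteq> {}"
  shows "(SUP j\<in>J. g j) \<le> (SUP i\<in>I. f i) \<longleftrightarrow> (\<forall>j\<in>J. \<exists>i\<in>I. g j \<le> f i)"
proof -
  have "(SUP i\<in>I. f i) = Max (f ` I)"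
    using assms by (subst Max_Sup) auto
  then have "y \<le> (SUP i\<in>I. f i) \<longleftrightarrow> (\<exists>i\<in>I. y \<le> f i)" for y
    using assms by (simp add: Max_ge_iff)
  then show ?thesis
    unfolding SUP_le_iff by blast
qed

lemma proj_in_trop_halfspace_iff:
  fixes x :: "ereal ^ 'n::finite"
  assumes "I \<noteq> {}" "x \<in> rmax_nonzero"
  shows "proj x \<in> trop_halfspace a I \<longleftrightarrow>
    (\<forall>j\<in>-I. \<exists>i\<in>I. x $ j - ereal (a $ j) \<le> x $ i - ereal (a $ i))"
    (is "_ \<longleftrightarrow> ?R x")
proof -
  have shift: "ereal c + s - ereal u \<le> ereal c + t - ereal w \<longleftrightarrow> s - ereal u \<le> t - ereal w" for c s t u w
    by (cases s; cases t) (auto simp: algebra_simps)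
  have self: "x \<in> proj x"
    by (auto simp: proj_def vec_eq_iff intro!: exI[of _ "0::real"] simp flip: zero_ereal_def)
  have "?R x" if y: "y \<in> rmax_nonzero" "?R y" "proj x = proj y" for y
  proof -
    from self y(3) obtain c where "x = (\<chi> i. ereal c + y $ i)"
      by (auto simp: proj_def)
    then show ?thesis
      using y(2) by (simp add: shift)
  qed
  then show ?thesis
    using assms by (auto simp: trop_halfspace_def SUP_le_SUP_finite_iff)
qed

lemma trop_halfspace_unique:
  fixes a b :: "real ^ 'n::finite"
  assumes I: "I \<noteq> {}" "I \<noteq> UNIV" and J: "J \<noteq> {}" "J \<noteq> UNIV"
    and eq: "trop_halfspace a I = trop_halfspace b J"
  shows "proj (real_vec a) = proj (real_vec b)" and "I = J"
proof -
  have sub: "I' \<subseteq> J'" if "I' \<noteq> {}" "I' \<noteq> UNIV" "J' \<noteq> {}" "trop_halfspace a' I' = trop_halfspace b' J'"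
    for I' J' and a' b' :: "real ^ 'n"
  proof
    fix k assume k: "k \<in> I'"
    define x :: "ereal ^ 'n" where "x = (\<chi> l. if l = k then 0 else -\<infinity>)"
    have x: "x \<in> rmax_nonzero"
      by (auto simp: x_def rmax_nonzero_def rmax_def vec_eq_iff)
    have "proj x \<in> trop_halfspace a' I'"
      using k by (subst proj_in_trop_halfspace_iff[OF that(1) x]) (auto simp: x_def)
    then have "proj x \<in> trop_halfspace b' J'"
      using that by simp
    then have *: "\<forall>j\<in>-J'. \<exists>i\<in>J'. x $ j - ereal (b' $ j) \<le> x $ i - ereal (b' $ i)"
      by (subst (asm) proj_in_trop_halfspace_iff[OF that(3) x])
    show "k \<in> J'"
    proof (rule ccontr)
      assume "k \<notin> J'"
      with * obtain i where "i \<in> J'" "x $ k - ereal (b' $ k) \<le> x $ i - ereal (b' $ i)"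
        by auto
      with \<open>k \<notin> J'\<close> show False
        by (auto simp: x_def zero_ereal_def split: if_splits)
    qed
  qed
  show IJ: "I = J"
    using sub[OF I J(1) eq] sub[OF J I(1) eq[symmetric]] by blast
  have le: "b' $ i - a' $ i \<le> b' $ j - a' $ j"
    if ij: "i \<in> I" "j \<notin> I" and e: "trop_halfspace a' I = trop_halfspace b' I"
    for i j and a' b' :: "real ^ 'n"
  proof -
    define x :: "ereal ^ 'n" where
      "x = (\<chi> l. if l = i then ereal (a' $ i) else if l = j then ereal (a' $ j) else -\<infinity>)"
    have x: "x \<in> rmax_nonzero"
      by (auto simp: x_def rmax_nonzero_def rmax_def vec_eq_iff)
    have "proj x \<in> trop_halfspace a' I"
      using ij by (subst proj_in_trop_halfspace_iff[OF I(1) x]) (auto simp: x_def intro!: bexI[of _ i])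
    then have "proj x \<in> trop_halfspace b' I"
      using e by simp
    then have "\<exists>k\<in>I. x $ j - ereal (b' $ j) \<le> x $ k - ereal (b' $ k)"
      using ij by (subst (asm) proj_in_trop_halfspace_iff[OF I(1) x]) auto
    with ij show ?thesis
      by (auto simp: x_def split: if_splits)
  qed
  have const: "b $ i - a $ i = b $ j - a $ j" if "i \<in> I" "j \<notin> I" for i j
    using le[OF that, of a b] le[OF that, of b a] eq IJ by simp
  obtain i0 j0 where ij0: "i0 \<in> I" "j0 \<notin> I"
    using I by auto
  define d where "d = b $ i0 - a $ i0"
  have d: "b $ k = d + a $ k" for k
    using const[OF ij0] const[of k j0] const[of i0 k] ij0 by (cases "k \<in> I") (auto simp: d_def)
  have "(\<exists>c. y = (\<chi> i. ereal c + real_vec a $ i)) \<longleftrightarrow> (\<exists>c. y = (\<chi> i. ereal c + real_vec b $ i))" for y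
  proof safe
    fix c
    show "\<exists>c'. (\<chi> i. ereal c + real_vec a $ i) = (\<chi> i. ereal c' + real_vec b $ i)"
      by (rule exI[of _ "c - d"]) (simp add: real_vec_def vec_eq_iff d)
    show "\<exists>c'. (\<chi> i. ereal c + real_vec b $ i) = (\<chi> i. ereal c' + real_vec a $ i)"
      by (rule exI[of _ "c + d"]) (simp add: real_vec_def vec_eq_iff d)
  qed
  then show "proj (real_vec a) = proj (real_vec b)"
    by (auto simp: proj_def)
qed

lemma apex_trop_halfspace:
  fixes a :: "real ^ 'n::finite"
  assumes "I \<noteq> {}" "I \<noteq> UNIV"
  shows "apex (trop_halfspace a I) = proj (real_vec a)"
  unfolding apex_def
  by (rule the_equality) (use assms trop_halfspace_unique(1) in \<open>blast+\<close>)

end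

theory Submission
  imports Defs
begin

text \<open>
  Let \<open>P = \<Inter>\<Gamma>\<close> and suppose \<open>P \<inter> H \<subseteq> H'\<close> and \<open>P \<inter> H' \<subseteq> H\<close>, while some \<open>x \<in> P\<close> lies
  outside \<open>H'\<close>, hence outside \<open>H\<close>. Choose representatives \<open>a\<close>, \<open>b\<close> of the two apices such that
  \<open>x \<le> a\<close> and \<open>x \<le> b\<close> are tight; \<open>x \<notin> H = H(a, I)\<close> means that \<open>x\<close> touches \<open>a\<close> outside the
  sectors \<open>I\<close> only. If \<open>m = max (a - b)\<close> were positive, the point \<open>z = max x (a - m)\<close> of the
  tropical segment from \<open>x\<close> to \<open>a\<close> would still be outside \<open>H\<close>. But \<open>z \<le> b\<close>, with equality in a
  sector of \<open>H'\<close> because \<open>a \<in> H'\<close>, so \<open>z \<in> P \<inter> H'\<close>, a contradiction. Thus \<open>a \<le> b\<close>, and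
  \<open>b \<le> a\<close> by symmetry.
\<close>

lemma proj_shift:
  fixes a :: "real ^ 'n"
  shows "proj (real_vec (\<chi> k. a $ k + c)) = proj (real_vec a)"
proof -
  have "\<exists>e'. (\<chi> i. ereal (e + (a $ i + c))) = (\<chi> i. ereal (e' + a $ i))" for e
    by (rule exI[of _ "e + c"]) (simp add: vec_eq_iff)
  moreover have "\<exists>e'. (\<chi> i. ereal (e + a $ i)) = (\<chi> i. ereal (e' + (a $ i + c)))" for e
    by (rule exI[of _ "e - c"]) (simp add: vec_eq_iff)
  ultimately show ?thesis
    unfolding proj_def real_vec_def by auto
qed

lemma real_vec_nonzero: "real_vec a \<in> rmax_nonzero"
  by (simp add: real_vec_def rmax_nonzero_def rmax_def vec_eq_iff)

lemma max_nonzero: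
  assumes "x \<in> rmax_nonzero" "y \<in> rmax_nonzero"
  shows "(\<chi> k. max (x $ k) (y $ k)) \<in> rmax_nonzero"
proof -
  obtain k where "x $ k \<noteq> -\<infinity>"
    using assms(1) by (auto simp: rmax_nonzero_def vec_eq_iff)
  then have "max (x $ k) (y $ k) \<noteq> -\<infinity>"
    by (auto simp: max_def)
  then show ?thesis
    using assms by (auto simp: rmax_nonzero_def rmax_def vec_eq_iff max_def)
qed

lemma trop_halfspace_shift:
  fixes a :: "real ^ 'n::finite"
  assumes "I \<noteq> {}"
  shows "trop_halfspace (\<chi> k. a $ k + c) I = trop_halfspace a I"
proof -
  have shift: "s - ereal (u + c) \<le> t - ereal (w + c) \<longleftrightarrow> s - ereal u \<le> t - ereal w" for s t u w
    by (cases s; cases t) auto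
  show ?thesis
    by (simp add: trop_halfspace_def SUP_le_SUP_finite_iff[OF assms] shift)
qed

text \<open>At a coordinate \<open>j\<close> outside \<open>I\<close> the maximum comes from
  \<open>x\<close> or from \<open>y\<close>; the sector dominating \<open>j\<close> for that point
  still does so, since its entry can only grow. This keeps tropical segments inside intersections of
  half-spaces.\<close>

lemma trop_halfspace_max:
  fixes x y :: "ereal ^ 'n::finite"
  assumes "I \<noteq> {}" and x: "x \<in> rmax_nonzero" and y: "y \<in> rmax_nonzero"
    and "proj x \<in> trop_halfspace a I" and "proj y \<in> trop_halfspace a I"
  shows "proj (\<chi> k. max (x $ k) (y $ k)) \<in> trop_halfspace a I"
proof -
  have mono: "s - ereal u \<le> t - ereal u" if "s \<le> t" for s t u
    using that by (rule ereal_minus_mono) simp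
  have X: "\<forall>j\<in>-I. \<exists>i\<in>I. x $ j - ereal (a $ j) \<le> x $ i - ereal (a $ i)"
    and Y: "\<forall>j\<in>-I. \<exists>i\<in>I. y $ j - ereal (a $ j) \<le> y $ i - ereal (a $ i)"
    using assms by (simp_all add: proj_in_trop_halfspace_iff)
  show ?thesis
    unfolding proj_in_trop_halfspace_iff[OF assms(1) max_nonzero[OF x y]]
  proof
    fix j assume "j \<in> -I"
    then obtain i i' where
      i: "i \<in> I" "x $ j - ereal (a $ j) \<le> x $ i - ereal (a $ i)" and
      i': "i' \<in> I" "y $ j - ereal (a $ j) \<le> y $ i' - ereal (a $ i')"
      using X Y by blast
    show "\<exists>i\<in>I. (\<chi> k. max (x $ k) (y $ k)) $ j - ereal (a $ j)
        \<le> (\<chi> k. max (x $ k) (y $ k)) $ i - ereal (a $ i)"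
    proof (cases "x $ j \<le> y $ j")
      case True
      then show ?thesis
        using i' order_trans[OF i'(2) mono[of "y $ i'" "max (x $ i') (y $ i')"]]
        by (intro bexI[of _ i']) (auto simp: max_absorb2)
    next
      case False
      then show ?thesis
        using i order_trans[OF i(2) mono[of "x $ i" "max (x $ i) (y $ i)"]]
        by (intro bexI[of _ i]) (auto simp: max_absorb1)
    qed
  qed
qed

text \<open>Shift \<open>a\<close> so that the largest entry of \<open>x - a\<close> becomes 0.
  Being outside the half-space means that this largest entry is attained only outside
  \<open>I\<close>, hence strictness on \<open>I\<close>.\<close>

lemma outside_halfspace_normalize:
  fixes x :: "ereal ^ 'n::finite"
  assumes I: "I \<noteq> {}" and x: "x \<in> rmax_nonzero" and out: "proj x \<notin> trop_halfspace a I"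
  obtains a' j where "proj (real_vec a') = proj (real_vec a)"
    and "trop_halfspace a' I = trop_halfspace a I"
    and "\<And>k. x $ k \<le> ereal (a' $ k)" and "\<And>i. i \<in> I \<Longrightarrow> x $ i < ereal (a' $ i)"
    and "j \<notin> I" and "x $ j = ereal (a' $ j)"
proof -
  define f where "f k = x $ k - ereal (a $ k)" for k
  obtain j0 where j0: "j0 \<notin> I" "\<And>i. i \<in> I \<Longrightarrow> f i < f j0"
    using out unfolding proj_in_trop_halfspace_iff[OF I x] f_def by (auto simp: not_le)
  have "Max (range f) \<in> range f"
    by (intro Max_in) auto
  then obtain j where "f j = Max (range f)"
    by (metis imageE)
  then have j: "f k \<le> f j" for k
    by simp
  have less: "f i < f j" if "i \<in> I" for i
    using j0(2)[OF that] j[of j0] by order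
  have fin: "x $ k \<noteq> \<infinity>" for k
    using x by (auto simp: rmax_nonzero_def rmax_def)
  obtain i where "i \<in> I"
    using I by blast
  \<comment> \<open>A strictly smaller value at a sector rules out \<open>-\<infinity>\<close>, so
    \<open>x $ j\<close> is real and can serve in the shift.\<close>
  with less have "f j \<noteq> -\<infinity>"
    by fastforce
  with fin[of j] obtain r where r: "x $ j = ereal r"
    by (cases "x $ j") (auto simp: f_def)
  show thesis
  proof (rule that[of "\<chi> k. a $ k + (r - a $ j)" j])
    show "x $ k \<le> ereal ((\<chi> k. a $ k + (r - a $ j)) $ k)" for k
      using j[of k] fin[of k] by (cases "x $ k") (auto simp: f_def r)
    show "x $ i < ereal ((\<chi> k. a $ k + (r - a $ j)) $ i)" if "i \<in> I" for i
      using less[OF that] fin[of i] by (cases "x $ i") (auto simp: f_def r)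
    show "j \<notin> I"
      using less by auto
  qed (simp_all add: proj_shift trop_halfspace_shift I r)
qed

text \<open>One inequality between the normalized apices; exchanging the half-spaces gives the
  other.\<close>

lemma apex_le:
  fixes x :: "ereal ^ 'n::finite" and a b :: "real ^ 'n"
  assumes I: "I \<noteq> {}" and J: "J \<noteq> {}" and x: "x \<in> rmax_nonzero"
    and \<Gamma>: "\<And>G. G \<in> \<Gamma> \<Longrightarrow> \<exists>c K. K \<noteq> {} \<and> G = trop_halfspace c K"
    and xP: "proj x \<in> \<Inter>\<Gamma>" and aP: "proj (real_vec a) \<in> \<Inter>\<Gamma>"
    and sub: "\<Inter>\<Gamma> \<inter> trop_halfspace b J \<subseteq> trop_halfspace a I"
    and aH: "proj (real_vec a) \<in> trop_halfspace b J"
    and xb: "\<And>k. x $ k \<le> ereal (b $ k)"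
    and xI: "\<And>i. i \<in> I \<Longrightarrow> x $ i < ereal (a $ i)"
    and xj: "j \<notin> I" "x $ j = ereal (a $ j)"
  shows "a $ k \<le> b $ k"
proof (rule ccontr)
  assume "\<not> a $ k \<le> b $ k"
  define m where "m = Max (range (\<lambda>k. a $ k - b $ k))"
  have m: "a $ k - b $ k \<le> m" for k
    unfolding m_def by simp
  from m[of k] \<open>\<not> a $ k \<le> b $ k\<close> have "m > 0"
    by linarith
  have "m \<in> range (\<lambda>k. a $ k - b $ k)"
    unfolding m_def by (intro Max_in) auto
  then obtain l where l: "m = a $ l - b $ l"
    by blast
  have aJ: "\<forall>j\<in>-J. \<exists>i\<in>J. a $ j - b $ j \<le> a $ i - b $ i"
    using aH unfolding proj_in_trop_halfspace_iff[OF J real_vec_nonzero]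
    by (simp add: real_vec_def)
  \<comment> \<open>The maximum may be attained at \<open>l\<close> outside \<open>J\<close>; since
    the class of \<open>a\<close> lies in the half-space at \<open>b\<close>, a sector in
    \<open>J\<close> attains it too.\<close>
  obtain i where i: "i \<in> J" "a $ i - b $ i = m"
  proof (cases "l \<in> J")
    case False
    with aJ obtain i where "i \<in> J" "m \<le> a $ i - b $ i"
      by (auto simp: l)
    with m[of i] show thesis
      by (intro that[of i]) auto
  qed (use l that in blast)
  \<comment> \<open>Subtracting \<open>m\<close> puts \<open>a\<close> below \<open>b\<close>, with
    equality at \<open>i\<close>, without changing its projective class.\<close>
  define y where "y = real_vec (\<chi> k. a $ k + (- m))"
  define z where "z = (\<chi> k. max (x $ k) (y $ k))"
  have y: "y \<in> rmax_nonzero"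
    by (simp add: y_def real_vec_nonzero)
  have yk: "y $ k = ereal (a $ k - m)" for k
    by (simp add: y_def real_vec_def)
  have z: "z \<in> rmax_nonzero"
    unfolding z_def by (rule max_nonzero[OF x y])
  have "proj y = proj (real_vec a)"
    unfolding y_def by (rule proj_shift)
  then have "proj z \<in> G" if "G \<in> \<Gamma>" for G
    using \<Gamma>[OF that] xP aP that trop_halfspace_max[OF _ x y] unfolding z_def by (metis InterD)
  then have zP: "proj z \<in> \<Inter>\<Gamma>"
    by blast
  have zb: "z $ k \<le> ereal (b $ k)" for k
    using xb[of k] m[of k] by (simp add: z_def yk)
  have "z $ i = ereal (b $ i)"
    using zb[of i] i(2) by (intro antisym) (auto simp: z_def yk)
  moreover have "z $ k - ereal (b $ k) \<le> 0" for k
    using zb[of k] by (cases "z $ k") auto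
  ultimately have "proj z \<in> trop_halfspace b J"
    unfolding proj_in_trop_halfspace_iff[OF J z]
    using i(1) by (auto intro!: bexI[of _ i] simp: zero_ereal_def)
  with zP sub have "proj z \<in> trop_halfspace a I"
    by blast
  with xj(1) obtain i' where i': "i' \<in> I" "z $ j - ereal (a $ j) \<le> z $ i' - ereal (a $ i')"
    unfolding proj_in_trop_halfspace_iff[OF I z] by blast
  \<comment> \<open>As \<open>m > 0\<close>, \<open>y\<close> is strictly below \<open>a\<close>, so
    \<open>z\<close> inherits from \<open>x\<close> equality at \<open>j\<close> and strictness on
    \<open>I\<close>.\<close>
  have "z $ j = ereal (a $ j)"
    using \<open>m > 0\<close> by (simp add: z_def yk xj(2) max_def)
  moreover have "z $ i' < ereal (a $ i')"
    using xI[OF i'(1)] \<open>m > 0\<close> by (simp add: z_def yk)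
  ultimately show False
    using i'(2) by (cases "z $ i'") auto
qed

theorem theorem4:
  fixes C :: "(ereal ^ 'n::finite) set set"
    and \<Gamma> :: "(ereal ^ 'n) set set set"
    and H H' :: "(ereal ^ 'n) set set"
  assumes "real_polyhedral_cone C"
    and "finite \<Gamma>" and "\<Gamma> \<subseteq> Sigma_halfspaces C"
    and "H \<in> Sigma_halfspaces C" and "H' \<in> Sigma_halfspaces C"
    and "apex H \<noteq> apex H'"
    and "H' \<notin> tau C \<Gamma>"
    and "H' \<in> tau C ({H} \<union> \<Gamma>)"
  shows "H \<notin> tau C ({H'} \<union> \<Gamma>)"
proof
  assume "H \<in> tau C ({H'} \<union> \<Gamma>)"
  then have sub: "\<Inter>\<Gamma> \<inter> H' \<subseteq> H"
    by (auto simp: tau_def)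
  have sub': "\<Inter>\<Gamma> \<inter> H \<subseteq> H'"
    using assms(8) by (auto simp: tau_def)
  \<comment> \<open>An empty \<open>\<Gamma>\<close> has the whole space as intersection, so the two
    inclusions would force \<open>H = H'\<close>, against the distinct apices.\<close>
  have "\<Gamma> \<noteq> {}"
    using sub sub' assms(6) by auto
  with assms(5,7) obtain X where X: "X \<in> \<Inter>\<Gamma>" "X \<notin> H'"
    by (auto simp: tau_def)
  then have "X \<notin> H"
    using sub' by blast
  have \<Gamma>: "\<exists>c K. K \<noteq> {} \<and> G = trop_halfspace c K" "C \<subseteq> G" if "G \<in> \<Gamma>" for G
    using assms(3) that unfolding Sigma_halfspaces_def by blast+
  obtain G where "G \<in> \<Gamma>" "X \<in> G"
    using X(1) \<open>\<Gamma> \<noteq> {}\<close> by blast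
  with \<Gamma>(1) obtain x where x: "x \<in> rmax_nonzero" "X = proj x"
    by (auto simp: trop_halfspace_def)
  obtain a I where a: "I \<noteq> {}" "I \<noteq> UNIV" "H = trop_halfspace a I" "C \<subseteq> H" "proj (real_vec a) \<in> C"
    using assms(4) by (auto simp: Sigma_halfspaces_def)
  obtain b J where b: "J \<noteq> {}" "J \<noteq> UNIV" "H' = trop_halfspace b J" "C \<subseteq> H'" "proj (real_vec b) \<in> C"
    using assms(5) by (auto simp: Sigma_halfspaces_def)
  \<comment> \<open>Both apices are normalized against the same representative \<open>x\<close>,
    which makes \<open>a'\<close> and \<open>b'\<close> comparable entrywise.\<close>
  obtain a' j where a': "proj (real_vec a') = proj (real_vec a)" "trop_halfspace a' I = H"
    "\<And>k. x $ k \<le> ereal (a' $ k)" "\<And>i. i \<in> I \<Longrightarrow> x $ i < ereal (a' $ i)"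
    "j \<notin> I" "x $ j = ereal (a' $ j)"
    using outside_halfspace_normalize[OF a(1) x(1)] \<open>X \<notin> H\<close> unfolding x(2) a(3) by metis
  obtain b' j' where b': "proj (real_vec b') = proj (real_vec b)" "trop_halfspace b' J = H'"
    "\<And>k. x $ k \<le> ereal (b' $ k)" "\<And>i. i \<in> J \<Longrightarrow> x $ i < ereal (b' $ i)"
    "j' \<notin> J" "x $ j' = ereal (b' $ j')"
    using outside_halfspace_normalize[OF b(1) x(1)] X(2) unfolding x(2) b(3) by metis
  have xP: "proj x \<in> \<Inter>\<Gamma>"
    using X(1) x(2) by simp
  have CP: "C \<subseteq> \<Inter>\<Gamma>"
    using \<Gamma>(2) by blast
  have "a' $ k \<le> b' $ k" for k
    by (rule apex_le[OF a(1) b(1) x(1) \<Gamma>(1) xP _ _ _ b'(3) a'(4-6)])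
      (use CP a(5) b(4) sub in \<open>auto simp: a'(1,2) b'(2)\<close>)
  moreover have "b' $ k \<le> a' $ k" for k
    by (rule apex_le[OF b(1) a(1) x(1) \<Gamma>(1) xP _ _ _ a'(3) b'(4-6)])
      (use CP b(5) a(4) sub' in \<open>auto simp: b'(1,2) a'(2)\<close>)
  ultimately have "a' = b'"
    by (simp add: vec_eq_iff order_antisym)
  then show False
    using assms(6) a b a'(1) b'(1) by (simp add: apex_trop_halfspace)
qed

end
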